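(* Let $\mathcal M=(M,\rho)$ be an incommensurable finite metric space consisting of more than three points. Then any minimal filling of $\mathcal M$ (which is a tree whose vertices of degree $1$ and $2$ all belong to $M$) contains a non-degenerate interior edge.
   Context: A finite graph $G=(V,E)$ joins $M$ if it is connected and $M\subset V$; vertices in $M$ are boundary vertices, and the others are interior vertices. For a weight function $\omega:E\to[0,\infty)$, $d_\omega(u,v)$ is the least weight (sum of $\omega$ over edges) of a path in $G$ joining $u$ and $v$, and $\omega(G)=\sum_{e\in E}\omega(e)$. The weighted graph $(G,\omega)$ is a filling of $(M,\rho)$ if $G$ joins $M$ and $\rho(p,q)\le d_\omega(p,q)$ for all $p,q\in M$. A minimal filling is a filling whose weight $\omega(G)$ is least among all fillings of $(M,\rho)$ (over all connected graphs $G$ joining $M$). An edge $e$ is non-degenerate if $\omega(e)>0$. An interior edge is an edge both of whose vertices are interior. A finite metric space $(M,\rho)$ is incommensurable if its non-zero distances, i.e. the family $\rho(p,q)$ indexed by the two-element subsets $\{p,q\}\subset M$, are linearly independent over the field $\mathbb Q$. *)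

theory Defs
  imports
    "HOL-Analysis.Abstract_Metric_Spaces"
    "HOL-Library.Ramsey"
    "HOL-Library.Infinite_Typeclass"
begin

text \<open>
  Graphs are finite, undirected and simple: an edge is a two-element set of vertices.
\<close>

definition fin_graph :: "'a set \<Rightarrow> 'a set set \<Rightarrow> bool" where
  "fin_graph V E \<longleftrightarrow> finite V \<and> E \<subseteq> [V]\<^bsup>2\<^esup>"

text \<open>A path is given by the list of its (pairwise different) vertices; one-vertex paths are allowed.\<close>

definition graph_path :: "'a set \<Rightarrow> 'a set set \<Rightarrow> 'a list \<Rightarrow> bool" where
  "graph_path V E p \<longleftrightarrow>
     p \<noteq> [] \<and> distinct p \<and> set p \<subseteq> V \<and> successively (\<lambda>x y. {x, y} \<in> E) p"

definition paths_between :: "'a set \<Rightarrow> 'a set set \<Rightarrow> 'a \<Rightarrow> 'a \<Rightarrow> 'a list set" where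
  "paths_between V E u v = {p. graph_path V E p \<and> hd p = u \<and> last p = v}"

definition path_edges :: "'a list \<Rightarrow> 'a set list" where
  "path_edges p = map2 (\<lambda>x y. {x, y}) p (tl p)"

definition path_weight :: "('a set \<Rightarrow> real) \<Rightarrow> 'a list \<Rightarrow> real" where
  "path_weight w p = sum_list (map w (path_edges p))"

definition graph_connected :: "'a set \<Rightarrow> 'a set set \<Rightarrow> bool" where
  "graph_connected V E \<longleftrightarrow> V \<noteq> {} \<and> (\<forall>u\<in>V. \<forall>v\<in>V. paths_between V E u v \<noteq> {})"

definition graph_acyclic :: "'a set \<Rightarrow> 'a set set \<Rightarrow> bool" where
  "graph_acyclic V E \<longleftrightarrow>
     \<not> (\<exists>p. graph_path V E p \<and> 3 \<le> length p \<and> {last p, hd p} \<in> E)"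

definition is_tree :: "'a set \<Rightarrow> 'a set set \<Rightarrow> bool" where
  "is_tree V E \<longleftrightarrow> graph_connected V E \<and> graph_acyclic V E"

definition vertex_degree :: "'a set set \<Rightarrow> 'a \<Rightarrow> nat" where
  "vertex_degree E v = card {e \<in> E. v \<in> e}"

text \<open>
  In a finite connected graph there are only finitely many paths between two given vertices, and
  at least one, so that the minimum exists.
\<close>

definition graph_dist :: "'a set \<Rightarrow> 'a set set \<Rightarrow> ('a set \<Rightarrow> real) \<Rightarrow> 'a \<Rightarrow> 'a \<Rightarrow> real" where
  "graph_dist V E w u v = Min (path_weight w ` paths_between V E u v)"

definition graph_weight :: "'a set set \<Rightarrow> ('a set \<Rightarrow> real) \<Rightarrow> real" where
  "graph_weight E w = (\<Sum>e\<in>E. w e)"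

definition joins :: "'a set \<Rightarrow> 'a set set \<Rightarrow> 'a set \<Rightarrow> bool" where
  "joins V E M \<longleftrightarrow> fin_graph V E \<and> graph_connected V E \<and> M \<subseteq> V"

definition is_filling ::
  "'a set \<Rightarrow> ('a \<Rightarrow> 'a \<Rightarrow> real) \<Rightarrow> 'a set \<Rightarrow> 'a set set \<Rightarrow> ('a set \<Rightarrow> real) \<Rightarrow> bool" where
  "is_filling M \<rho> V E w \<longleftrightarrow>
     joins V E M \<and> (\<forall>e\<in>E. 0 \<le> w e) \<and> (\<forall>p\<in>M. \<forall>q\<in>M. \<rho> p q \<le> graph_dist V E w p q)"

text \<open>
  All fillings have their vertices in the type of the points of \<open>M\<close>. That type is required to be
  infinite: it then contains a copy, fixing \<open>M\<close> pointwise, of every finite graph joining \<open>M\<close>.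
  Over a finite type the number of interior vertices would be bounded artificially.
\<close>

definition minimal_filling ::
  "'a::infinite set \<Rightarrow> ('a \<Rightarrow> 'a \<Rightarrow> real) \<Rightarrow> 'a set \<Rightarrow> 'a set set \<Rightarrow> ('a set \<Rightarrow> real) \<Rightarrow> bool" where
  "minimal_filling M \<rho> V E w \<longleftrightarrow>
     is_filling M \<rho> V E w \<and>
     (\<forall>V' E' w'. is_filling M \<rho> V' E' w' \<longrightarrow> graph_weight E w \<le> graph_weight E' w')"

definition interior_edge :: "'a set \<Rightarrow> 'a set \<Rightarrow> bool" where
  "interior_edge M e \<longleftrightarrow> e \<inter> M = {}"

definition nondegenerate_edge :: "('a set \<Rightarrow> real) \<Rightarrow> 'a set \<Rightarrow> bool" where
  "nondegenerate_edge w e \<longleftrightarrow> 0 < w e"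

text \<open>
  The distance of an unordered pair; this is well defined for symmetric \<open>\<rho>\<close>.
\<close>

definition pair_dist :: "('a \<Rightarrow> 'a \<Rightarrow> real) \<Rightarrow> 'a set \<Rightarrow> real" where
  "pair_dist \<rho> e = (THE r. \<exists>p q. p \<noteq> q \<and> e = {p, q} \<and> r = \<rho> p q)"

text \<open>
  Linear independence over the rationals of the distances as a family indexed by unordered pairs;
  in particular, different pairs have different distances.
\<close>

definition incommensurable :: "'a set \<Rightarrow> ('a \<Rightarrow> 'a \<Rightarrow> real) \<Rightarrow> bool" where
  "incommensurable M \<rho> \<longleftrightarrow>
     (\<forall>c :: 'a set \<Rightarrow> rat.
        (\<Sum>e\<in>[M]\<^bsup>2\<^esup>. of_rat (c e) * pair_dist \<rho> e) = 0 \<longrightarrow> (\<forall>e\<in>[M]\<^bsup>2\<^esup>. c e = 0))"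

lemma pair_dist_doubleton:
  assumes "\<And>x y. \<rho> x y = \<rho> y x" and "p \<noteq> q"
  shows "pair_dist \<rho> {p, q} = \<rho> p q"
  unfolding pair_dist_def
  by (rule the_equality) (use assms in \<open>auto simp: doubleton_eq_iff\<close>)

end

theory Submission
  imports Defs
begin

text \<open>
  Suppose that the interior edges of the tree all have weight zero.

  First, the tree must then be a star metrically. A minimal filling cannot have two edges of
  positive weight at a boundary vertex \<open>b\<close>, where vertices at distance zero from \<open>b\<close> are identified with
  \<open>b\<close>: incommensurability makes the triangle inequality strict, so both edges can be moved to a new
  vertex close to \<open>b\<close>, which saves weight (\<open>split_boundary_vertex\<close>). Since every edge of positive
  weight meets \<open>M\<close>, what remains are \<open>|M|\<close> legs of positive weight \<open>h p\<close> with
  \<open>\<rho> p q \<le> h p + h q\<close> (\<open>star_weights\<close>).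

  Second, a star on at least four points is not optimal (\<open>double_star_beats_star\<close>). Call a pair tight
  if \<open>\<rho> p q = h p + h q\<close>. Incommensurability makes the incidence vectors of the tight pairs linearly
  independent, so that the sums \<open>\<delta> p + \<delta> q\<close> over the tight pairs can be prescribed arbitrarily for a
  perturbation \<open>\<delta>\<close> of \<open>h\<close>. If no double star that splits off two points \<open>a\<close> and \<open>b\<close> is
  lighter, then the tight pair \<open>{a, b}\<close> carries at least half of the unit of dual weight available at
  \<open>a\<close>; this cannot hold for three different \<open>b\<close>. The lighter double star is realised
  as a filling (\<open>double_star_filling\<close>), which contradicts minimality.

  Trees are handled through their cuts: each edge \<open>e\<close> divides the vertices into two sides, and the
  distance of two vertices is the total weight of the edges separating them. Conversely, a weighted sum
  of cut pseudometrics certifies that a modified graph is still a filling (\<open>filling_criterion\<close>). Edges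
  of weight zero are never contracted; the clusters they form take the place of single vertices.
\<close>

section \<open>Walks, paths and a criterion for fillings\<close>

text \<open>
  Two vertices are linked if they are the ends of some walk along edges of \<open>E\<close>. No vertex set is
  mentioned: \<open>linked E x x\<close> holds for every \<open>x\<close>.
\<close>

definition linked :: "'a set set \<Rightarrow> 'a \<Rightarrow> 'a \<Rightarrow> bool" where
  "linked E = (\<lambda>x y. {x, y} \<in> E)\<^sup>*\<^sup>*"

lemma linked_refl [simp]: "linked E x x"
  by (simp add: linked_def)

lemma linked_edge: "{x, y} \<in> E \<Longrightarrow> linked E x y"
  unfolding linked_def by (rule r_into_rtranclp)

lemma linked_trans [trans]: "linked E x y \<Longrightarrow> linked E y z \<Longrightarrow> linked E x z"
  unfolding linked_def by (rule rtranclp_trans)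

lemma linked_sym: "linked E x y \<Longrightarrow> linked E y x"
  unfolding linked_def
proof (induction rule: rtranclp_induct)
  case (step y z)
  have "(\<lambda>x y. {x, y} \<in> E)\<^sup>*\<^sup>* z y"
    using step(2) by (simp add: r_into_rtranclp insert_commute)
  then show ?case using step(3) by (rule rtranclp_trans)
qed simp

lemma linked_mono:
  assumes "linked E x y" and "\<And>a b. {a, b} \<in> E \<Longrightarrow> linked F a b"
  shows "linked F x y"
  using assms(1) unfolding linked_def[of E]
  by (induction rule: rtranclp_induct) (auto intro: linked_trans assms(2))

lemma linked_crossing_edge:
  assumes "linked E x y" and "x \<in> S" and "y \<notin> S"
  shows "\<exists>a b. {a, b} \<in> E \<and> a \<in> S \<and> b \<notin> S"
  using assms unfolding linked_def
  by (induction rule: rtranclp_induct) blast+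

lemma linked_if_path:
  assumes "successively (\<lambda>x y. {x, y} \<in> E) p" and "p \<noteq> []"
  shows "linked E (hd p) (last p)"
  using assms
proof (induction p rule: induct_list012)
  case (3 x y zs)
  then have "{x, y} \<in> E" "linked E y (last (y # zs))" by auto
  then show ?case by (auto intro: linked_trans linked_edge)
qed auto

lemma path_if_linked:
  assumes "linked E u v" and "u \<in> V" and "E \<subseteq> [V]\<^bsup>2\<^esup>"
  shows "\<exists>p. graph_path V E p \<and> hd p = u \<and> last p = v"
  using assms(1) unfolding linked_def
proof (induction rule: rtranclp_induct)
  case base
  show ?case using assms(2) by (intro exI[of _ "[u]"]) (auto simp: graph_path_def)
next
  case (step y z)
  then obtain p where p: "graph_path V E p" "hd p = u" "last p = y" by blast
  have z: "z \<in> V" using step(2) assms(3) by (auto dest!: subsetD)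
  show ?case
  proof (cases "z \<in> set p")
    case True
    then obtain q r where qr: "p = q @ z # r" by (meson split_list)
    with p(1) have "graph_path V E (q @ [z])"
      by (auto simp: graph_path_def successively_append_iff)
    moreover have "hd (q @ [z]) = u" using p(2) qr by (cases q) auto
    ultimately show ?thesis by (intro exI[of _ "q @ [z]"]) auto
  next
    case False
    with p step(2) z have "graph_path V E (p @ [z])"
      by (auto simp: graph_path_def successively_append_iff)
    moreover have "hd (p @ [z]) = u" using p by (auto simp: graph_path_def)
    ultimately show ?thesis by (intro exI[of _ "p @ [z]"]) auto
  qed
qed

lemma path_weight_Cons:
  "path_weight w (x # y # p) = w {x, y} + path_weight w (y # p)"
  by (simp add: path_weight_def path_edges_def)

lemma path_weight_singleton [simp]: "path_weight w [x] = 0"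
  by (simp add: path_weight_def path_edges_def)

lemma finite_paths_between: "finite V \<Longrightarrow> finite (paths_between V E u v)"
  by (rule finite_subset[OF _ finite_subset_distinct[of V]])
     (auto simp: paths_between_def graph_path_def)

lemma path_weight_ge:
  fixes D :: "'a \<Rightarrow> 'a \<Rightarrow> real"
  assumes "\<And>x. D x x \<le> 0" and "\<And>x y z. D x z \<le> D x y + D y z"
    and "\<And>x y. {x, y} \<in> E \<Longrightarrow> D x y \<le> w {x, y}"
    and "successively (\<lambda>x y. {x, y} \<in> E) p" and "p \<noteq> []"
  shows "D (hd p) (last p) \<le> path_weight w p"
  using assms(4,5)
proof (induction p rule: induct_list012)
  case (3 x y zs)
  then have "D y (last (y # zs)) \<le> path_weight w (y # zs)" by auto
  moreover have "D x y \<le> w {x, y}" using 3(3) assms(3) by auto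
  ultimately show ?case
    using assms(2)[of x "last (y # zs)" y] by (simp add: path_weight_Cons)
qed (auto simp: assms(1))

text \<open>
  A lower bound on the path distance is certified by any pseudometric that does not exceed the
  weight of an edge on the two ends of that edge.
\<close>

lemma filling_criterion:
  fixes D :: "'a \<Rightarrow> 'a \<Rightarrow> real"
  assumes G: "fin_graph V E" and M: "M \<subseteq> V" and c: "c \<in> V"
    and conn: "\<And>v. v \<in> V \<Longrightarrow> linked E c v"
    and nonneg: "\<And>e. e \<in> E \<Longrightarrow> 0 \<le> w e"
    and D: "\<And>x. D x x \<le> 0" "\<And>x y z. D x z \<le> D x y + D y z"
    and edge: "\<And>x y. {x, y} \<in> E \<Longrightarrow> D x y \<le> w {x, y}"
    and \<rho>: "\<And>p q. p \<in> M \<Longrightarrow> q \<in> M \<Longrightarrow> \<rho> p q \<le> D p q"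
  shows "is_filling M \<rho> V E w"
proof -
  have ne: "paths_between V E u v \<noteq> {}" if "u \<in> V" "v \<in> V" for u v
  proof -
    have "linked E u v" using conn that by (meson linked_sym linked_trans)
    from path_if_linked[OF this that(1)] G show ?thesis
      by (auto simp: fin_graph_def paths_between_def)
  qed
  have "\<rho> p q \<le> graph_dist V E w p q" if "p \<in> M" "q \<in> M" for p q
    unfolding graph_dist_def
  proof (rule Min.boundedI)
    show "finite (path_weight w ` paths_between V E p q)"
      using G by (intro finite_imageI finite_paths_between) (simp add: fin_graph_def)
    show "path_weight w ` paths_between V E p q \<noteq> {}" using ne that M by blast
    fix r assume "r \<in> path_weight w ` paths_between V E p q"
    then obtain l where l: "r = path_weight w l" "graph_path V E l" "hd l = p" "last l = q"
      by (auto simp: paths_between_def)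
    then have "D p q \<le> r" using path_weight_ge[of D E w l, OF D edge]
      by (auto simp: graph_path_def)
    with \<rho>[OF that] show "\<rho> p q \<le> r" by simp
  qed
  then show ?thesis
    using G M c ne nonneg by (auto simp: is_filling_def joins_def graph_connected_def)
qed

section \<open>Distances given by weighted cuts\<close>

text \<open>
  The cut pseudometric of a set: \<open>1\<close> if the set separates the two points, and \<open>0\<close> otherwise.
\<close>

definition cut_sep :: "'a set \<Rightarrow> 'a \<Rightarrow> 'a \<Rightarrow> real" where
  "cut_sep A x y = of_bool ((x \<in> A) \<noteq> (y \<in> A))"

lemma cut_sep_self [simp]: "cut_sep A x x = 0"
  by (simp add: cut_sep_def)

lemma cut_sep_commute: "cut_sep A x y = cut_sep A y x"
  by (auto simp: cut_sep_def)

lemma cut_sep_triangle: "cut_sep A x z \<le> cut_sep A x y + cut_sep A y z"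
  by (auto simp: cut_sep_def)

text \<open>
  The weighted sum of the cut pseudometrics of a family of sets.
\<close>

definition cut_dist :: "'i set \<Rightarrow> ('i \<Rightarrow> 'a set) \<Rightarrow> ('i \<Rightarrow> real) \<Rightarrow> 'a \<Rightarrow> 'a \<Rightarrow> real" where
  "cut_dist I A w x y = (\<Sum>i\<in>I. w i * cut_sep (A i) x y)"

lemma cut_dist_self [simp]: "cut_dist I A w x x = 0"
  by (simp add: cut_dist_def)

lemma cut_dist_commute: "cut_dist I A w x y = cut_dist I A w y x"
  by (simp add: cut_dist_def cut_sep_commute)

lemma cut_dist_triangle:
  assumes "\<And>i. i \<in> I \<Longrightarrow> 0 \<le> w i"
  shows "cut_dist I A w x z \<le> cut_dist I A w x y + cut_dist I A w y z"
  unfolding cut_dist_def sum.distrib[symmetric]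
  by (intro sum_mono) (metis assms cut_sep_triangle distrib_left mult_left_mono)

section \<open>Small steps and dual vectors\<close>

text \<open>
  Finitely many strict inequalities survive a sufficiently small perturbation.
\<close>

lemma uniform_positive_step:
  fixes f g :: "'i \<Rightarrow> real"
  assumes "finite A" and "\<And>x. x \<in> A \<Longrightarrow> 0 < f x"
  shows "\<exists>\<epsilon>>0. \<forall>x\<in>A. \<epsilon> * g x \<le> f x"
  using assms
proof (induction A rule: finite_induct)
  case empty
  show ?case by (intro exI[of _ 1]) auto
next
  case (insert a A)
  then obtain e where e: "e > 0" "\<forall>x\<in>A. e * g x \<le> f x" by auto
  define d where "d = f a / (1 + \<bar>g a\<bar>)"
  have fa: "f a > 0" using insert by auto
  have d: "d > 0" unfolding d_def using fa by simp
  have dga: "d * \<bar>g a\<bar> \<le> f a" unfolding d_def using fa by (simp add: field_simps)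
  have "min e d * g x \<le> f x" if "x \<in> insert a A" for x
  proof (cases "g x \<ge> 0")
    case True
    show ?thesis
    proof (cases "x = a")
      case True
      have "min e d * g x \<le> d * g x" using \<open>g x \<ge> 0\<close> by (intro mult_right_mono) auto
      then show ?thesis using dga True \<open>g x \<ge> 0\<close> by auto
    next
      case False
      have "min e d * g x \<le> e * g x" using \<open>g x \<ge> 0\<close> by (intro mult_right_mono) auto
      then show ?thesis using e False that by force
    qed
  next
    case False
    then have "min e d * g x \<le> 0" using e d by (intro mult_nonneg_nonpos) auto
    then show ?thesis using insert.prems[OF that] by simp
  qed
  then show ?case using e d by (intro exI[of _ "min e d"]) auto
qed

text \<open>
  The rows of a matrix over a field, if linearly independent, admit a dual family of column
  vectors. A new row is handled by subtracting from it the combination of the old rows that agrees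
  with it on the old dual vectors: the difference has a non-zero entry \<open>j\<close>, and the unit vector at
  \<open>j\<close>, corrected so that the old rows vanish on it, is dual to the new row up to scaling.
\<close>

lemma dual_vectors_if_independent:
  fixes f :: "'k \<Rightarrow> 'i \<Rightarrow> 'f::field"
  assumes "finite K" and "finite I"
    and "\<And>c. (\<And>i. i \<in> I \<Longrightarrow> (\<Sum>k\<in>K. c k * f k i) = 0) \<Longrightarrow> \<forall>k\<in>K. c k = 0"
  shows "\<forall>k\<in>K. \<exists>x. \<forall>l\<in>K. (\<Sum>i\<in>I. f l i * x i) = of_bool (l = k)"
  using assms(1,3)
proof (induction K rule: finite_induct)
  case empty
  show ?case by simp
next
  case (insert a K)
  have "\<forall>k\<in>K. c k = 0" if c: "\<And>i. i \<in> I \<Longrightarrow> (\<Sum>k\<in>K. c k * f k i) = 0" for c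
  proof -
    have eq: "(\<Sum>k\<in>K. (c(a := 0)) k * f k i) = (\<Sum>k\<in>K. c k * f k i)" for i
      using insert(2) by (intro sum.cong) auto
    have "\<forall>k\<in>insert a K. (c(a := 0)) k = 0"
      using insert(1,2) c eq by (intro insert.prems) auto
    then show ?thesis using insert(2) by (auto split: if_splits)
  qed
  then have "\<forall>k\<in>K. \<exists>x. \<forall>l\<in>K. (\<Sum>i\<in>I. f l i * x i) = of_bool (l = k)"
    by (rule insert.IH)
  then obtain X where X: "\<And>k l. k \<in> K \<Longrightarrow> l \<in> K \<Longrightarrow> (\<Sum>i\<in>I. f l i * X k i) = of_bool (l = k)"
    by metis
  define d where "d k = (\<Sum>i\<in>I. f a i * X k i)" for k
  have "\<exists>j\<in>I. f a j - (\<Sum>k\<in>K. d k * f k j) \<noteq> 0"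
  proof (rule ccontr)
    assume H: "\<not> ?thesis"
    define c where "c k = (if k = a then 1 else - d k)" for k
    have "(\<Sum>k\<in>K. c k * f k i) = - (\<Sum>k\<in>K. d k * f k i)" for i
      unfolding sum_negf[symmetric] c_def using insert(2) by (intro sum.cong) auto
    then have "(\<Sum>k\<in>insert a K. c k * f k i) = 0" if "i \<in> I" for i
      using H that insert(1,2) by (simp add: c_def)
    then have "\<forall>k\<in>insert a K. c k = 0" by (rule insert.prems)
    then show False by (auto simp: c_def)
  qed
  then obtain j where j: "j \<in> I" "f a j - (\<Sum>k\<in>K. d k * f k j) \<noteq> 0" (is "?g \<noteq> 0") by blast
  define u where "u i = of_bool (i = j) - (\<Sum>k\<in>K. f k j * X k i)" for i
  have ev: "(\<Sum>i\<in>I. f l i * u i) = f l j - (\<Sum>k\<in>K. f k j * (\<Sum>i\<in>I. f l i * X k i))" for l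
  proof -
    have "(\<Sum>i\<in>I. f l i * u i) = (\<Sum>i\<in>I. f l i * of_bool (i = j)) - (\<Sum>i\<in>I. \<Sum>k\<in>K. f k j * (f l i * X k i))"
      by (simp add: u_def right_diff_distrib sum_subtractf sum_distrib_left mult.left_commute)
    also have "(\<Sum>i\<in>I. f l i * of_bool (i = j)) = f l j"
      using j(1) assms(2) by (subst sum.remove[of _ j]) auto
    finally show ?thesis by (subst (asm) sum.swap) (simp add: sum_distrib_left)
  qed
  have uK: "(\<Sum>i\<in>I. f l i * u i) = 0" if "l \<in> K" for l
  proof -
    have "(\<Sum>k\<in>K. f k j * (\<Sum>i\<in>I. f l i * X k i)) = (\<Sum>k\<in>K. f k j * of_bool (l = k))"
      using X that by (intro sum.cong) auto
    also have "\<dots> = f l j" using that insert(1) by (subst sum.remove[of _ l]) auto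
    finally show ?thesis using ev by simp
  qed
  have ua: "(\<Sum>i\<in>I. f a i * u i) = ?g"
    using ev[of a] by (simp add: d_def mult.commute)
  define Y where "Y k i = (if k = a then u i / ?g else X k i - d k * (u i / ?g))" for k i
  have au: "(\<Sum>i\<in>I. f l i * (u i / ?g)) = of_bool (l = a)" if "l \<in> insert a K" for l
    using uK ua j(2) that insert(2) by (auto simp flip: sum_divide_distrib simp: field_simps)
  have "(\<Sum>i\<in>I. f l i * Y k i) = of_bool (l = k)" if kl: "k \<in> insert a K" "l \<in> insert a K" for k l
  proof (cases "k = a")
    case True
    then show ?thesis using au kl by (simp add: Y_def)
  next
    case False
    then have "(\<Sum>i\<in>I. f l i * Y k i) = (\<Sum>i\<in>I. f l i * X k i) - d k * (\<Sum>i\<in>I. f l i * (u i / ?g))"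
      by (simp add: Y_def right_diff_distrib sum_subtractf sum_distrib_left mult.left_commute)
    also have "\<dots> = of_bool (l = k)" using False kl au X insert(2) by (auto simp: d_def)
    finally show ?thesis .
  qed
  then show ?case by blast
qed

section \<open>Consequences of incommensurability\<close>

lemma pair_dist_eq:
  assumes "Metric_space M \<rho>" and "p \<noteq> q"
  shows "pair_dist \<rho> {p, q} = \<rho> p q"
  using assms Metric_space.commute by (intro pair_dist_doubleton) fastforce+

lemma strict_triangle_if_incommensurable:
  assumes met: "Metric_space M \<rho>" and "finite M" and inc: "incommensurable M \<rho>"
    and pqr: "p \<in> M" "q \<in> M" "r \<in> M" "p \<noteq> q" "p \<noteq> r" "q \<noteq> r"
  shows "\<rho> p q < \<rho> p r + \<rho> r q"
proof -
  have "\<rho> p q \<noteq> \<rho> p r + \<rho> r q"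
  proof
    assume eq: "\<rho> p q = \<rho> p r + \<rho> r q"
    define c :: "'a set \<Rightarrow> rat" where
      "c e = (if e = {p, q} then 1 else if e = {p, r} \<or> e = {r, q} then - 1 else 0)" for e
    have ne: "{p, q} \<noteq> {p, r}" "{p, q} \<noteq> {r, q}" "{p, r} \<noteq> {r, q}"
      using pqr by (auto simp: doubleton_eq_iff)
    have "(\<Sum>e\<in>[M]\<^bsup>2\<^esup>. of_rat (c e) * pair_dist \<rho> e)
        = (\<Sum>e\<in>{{p, q}, {p, r}, {r, q}}. of_rat (c e) * pair_dist \<rho> e)"
      using pqr by (intro sum.mono_neutral_right finite_imp_finite_nsets assms) (auto simp: c_def)
    also have "\<dots> = \<rho> p q - \<rho> p r - \<rho> r q"
      using ne pqr by (simp add: c_def pair_dist_eq[OF met])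
    finally have "\<forall>e\<in>[M]\<^bsup>2\<^esup>. c e = 0"
      using inc eq by (simp add: incommensurable_def)
    then have "c {p, q} = 0" using pqr by simp
    then show False by (simp add: c_def)
  qed
  moreover have "\<rho> p q \<le> \<rho> p r + \<rho> r q"
    using met pqr by (simp add: Metric_space.triangle)
  ultimately show ?thesis by simp
qed

text \<open>
  For weights \<open>h\<close> on the points of \<open>M\<close>, a tight pair satisfies \<open>\<rho> p q = h p + h q\<close>. A rational
  linear relation between the incidence vectors of the tight pairs is also one between
  their distances. Hence these vectors are independent over the rationals, and every tight pair has
  a dual vector; a pair that is not tight is served by the zero vector.
\<close>

lemma tight_pairs_dual:
  assumes met: "Metric_space M \<rho>" and fin: "finite M" and inc: "incommensurable M \<rho>"
    and ab: "a \<in> M" "b \<in> M" "a \<noteq> b"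
  shows "\<exists>\<eta> :: 'a \<Rightarrow> real. \<forall>p\<in>M. \<forall>q\<in>M. p \<noteq> q \<longrightarrow> \<rho> p q = h p + h q \<longrightarrow>
           \<eta> p + \<eta> q = of_bool ({p, q} = {a, b})"
proof -
  define H where "H = {e \<in> [M]\<^bsup>2\<^esup>. pair_dist \<rho> e = sum h e}"
  have fH: "finite H" unfolding H_def
    by (rule finite_subset[OF _ finite_imp_finite_nsets[OF fin, of 2]]) auto
  have Hiff: "{p, q} \<in> H \<longleftrightarrow> \<rho> p q = h p + h q" if "p \<in> M" "q \<in> M" "p \<noteq> q" for p q
    using that by (simp add: H_def pair_dist_eq[OF met])
  have indep: "\<forall>e\<in>H. c e = 0"
    if c: "\<And>i. i \<in> M \<Longrightarrow> (\<Sum>e\<in>H. c e * of_bool (i \<in> e)) = 0" for c :: "'a set \<Rightarrow> rat"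
  proof -
    define c' where "c' e = (if e \<in> H then c e else 0)" for e
    have "(\<Sum>e\<in>[M]\<^bsup>2\<^esup>. of_rat (c' e) * pair_dist \<rho> e) = (\<Sum>e\<in>H. of_rat (c e) * sum h e)"
      using fin
      by (intro sum.mono_neutral_cong_right finite_imp_finite_nsets) (auto simp: c'_def H_def)
    also have "\<dots> = (\<Sum>e\<in>H. \<Sum>i\<in>M. h i * of_rat (c e * of_bool (i \<in> e)))"
    proof (rule sum.cong)
      fix e assume "e \<in> H"
      then have "e \<subseteq> M" by (auto simp: H_def nsets_def)
      then have "sum h e = (\<Sum>i\<in>M. h i * of_bool (i \<in> e))"
        using fin by (intro sum.mono_neutral_cong_left) auto
      then show "of_rat (c e) * sum h e = (\<Sum>i\<in>M. h i * of_rat (c e * of_bool (i \<in> e)))"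
        by (auto simp: sum_distrib_left intro!: sum.cong)
    qed simp
    also have "\<dots> = (\<Sum>i\<in>M. h i * of_rat (\<Sum>e\<in>H. c e * of_bool (i \<in> e)))"
      by (subst sum.swap) (simp add: sum_distrib_left of_rat_sum)
    also have "\<dots> = 0" using c by simp
    finally have "\<forall>e\<in>[M]\<^bsup>2\<^esup>. c' e = 0" using inc by (simp add: incommensurable_def)
    then show ?thesis by (auto simp: c'_def H_def)
  qed
  have pair_sum: "(\<Sum>i\<in>M. of_bool (i \<in> {p, q}) * x i) = x p + x q"
    if "p \<in> M" "q \<in> M" "p \<noteq> q" for p q and x :: "'a \<Rightarrow> rat"
  proof -
    have "(\<Sum>i\<in>M. of_bool (i \<in> {p, q}) * x i) = (\<Sum>i\<in>{p, q}. x i)"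
      using fin that by (intro sum.mono_neutral_cong_right) auto
    then show ?thesis using that by simp
  qed
  show ?thesis
  proof (cases "{a, b} \<in> H")
    case True
    then obtain x :: "'a \<Rightarrow> rat"
      where x: "\<forall>e\<in>H. (\<Sum>i\<in>M. of_bool (i \<in> e) * x i) = of_bool (e = {a, b})"
      using dual_vectors_if_independent[where K = H and I = M and f = "\<lambda>e i. of_bool (i \<in> e) :: rat"]
        fH fin indep by blast
    have "of_rat (x p) + of_rat (x q) = (of_bool ({p, q} = {a, b}) :: real)"
      if "p \<in> M" "q \<in> M" "p \<noteq> q" "\<rho> p q = h p + h q" for p q
    proof -
      have "{p, q} \<in> H" using that Hiff by blast
      then have "x p + x q = of_bool ({p, q} = {a, b})"
        using x pair_sum[OF that(1-3)] by metis
      then show ?thesis by (simp flip: of_rat_add)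
    qed
    then show ?thesis by (intro exI[of _ "\<lambda>i. of_rat (x i)"]) blast
  next
    case False
    then have "{p, q} \<noteq> {a, b}" if "p \<in> M" "q \<in> M" "p \<noteq> q" "\<rho> p q = h p + h q" for p q
      using that Hiff by metis
    then show ?thesis by (intro exI[of _ "\<lambda>_. 0"]) simp
  qed
qed

text \<open>
  The weights \<open>h\<close> describe a star with centre outside \<open>M\<close>; \<open>S\<close>, \<open>k\<close> and \<open>t\<close> describe a double star,
  in which the points of \<open>S\<close> hang on one centre, the others on a second one, and the centres are joined
  by an edge of weight \<open>t\<close>. Suppose that no double star is lighter than the star. Fix a point \<open>a\<close>,
  and for each other point \<open>b\<close> let \<open>y b\<close> be the total of the vector dual to the pair \<open>{a, b}\<close>. Splitting
  off \<open>S = {a, b}\<close> gives \<open>y b \<ge> 1/2\<close>, and perturbing the star alone gives that the \<open>y b\<close> sum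
  to at most \<open>1\<close>. This is impossible, because there are at least three points \<open>b\<close>.
\<close>

lemma double_star_beats_star:
  fixes h :: "'a \<Rightarrow> real"
  assumes met: "Metric_space M \<rho>" and fin: "finite M" and inc: "incommensurable M \<rho>"
    and card: "3 < card M"
    and pos: "\<And>p. p \<in> M \<Longrightarrow> 0 < h p"
    and cover: "\<And>p q. p \<in> M \<Longrightarrow> q \<in> M \<Longrightarrow> p \<noteq> q \<Longrightarrow> \<rho> p q \<le> h p + h q"
  shows "\<exists>S k t. 0 \<le> t \<and> (\<forall>p\<in>M. 0 \<le> k p) \<and>
           (\<forall>p\<in>M. \<forall>q\<in>M. p \<noteq> q \<longrightarrow> \<rho> p q \<le> k p + k q + t * cut_sep S p q) \<and>
           sum k M + t < sum h M"
proof (rule ccontr)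
  assume none: "\<not> ?thesis"
  have opt: "sum h M \<le> sum k M + t"
    if "0 \<le> t" "\<forall>p\<in>M. 0 \<le> k p"
      "\<forall>p\<in>M. \<forall>q\<in>M. p \<noteq> q \<longrightarrow> \<rho> p q \<le> k p + k q + t * cut_sep S p q" for S k t
  proof (rule ccontr)
    assume "\<not> sum h M \<le> sum k M + t"
    then have "sum k M + t < sum h M" by simp
    with that have "\<exists>S k t. 0 \<le> t \<and> (\<forall>p\<in>M. 0 \<le> k p) \<and>
        (\<forall>p\<in>M. \<forall>q\<in>M. p \<noteq> q \<longrightarrow> \<rho> p q \<le> k p + k q + t * cut_sep S p q) \<and>
        sum k M + t < sum h M"
      by (intro exI[of _ S] exI[of _ k] exI[of _ t] conjI)
    with none show False by (rule notE)
  qed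
  \<comment> \<open>The first-order form of optimality: only the tight pairs restrict a small perturbation
    \<open>\<epsilon> * \<delta>\<close> of the star together with a bridge of length \<open>\<epsilon> * \<tau>\<close>.\<close>
  have perturb: "0 \<le> sum \<delta> M + \<tau>"
    if \<tau>: "0 \<le> \<tau>"
      and tight: "\<And>p q. p \<in> M \<Longrightarrow> q \<in> M \<Longrightarrow> p \<noteq> q \<Longrightarrow> \<rho> p q = h p + h q \<Longrightarrow>
                    0 \<le> \<delta> p + \<delta> q + \<tau> * cut_sep S p q" for S \<tau> and \<delta> :: "'a \<Rightarrow> real"
  proof -
    define A where "A = {(p, q). p \<in> M \<and> q \<in> M \<and> (p = q \<or> \<rho> p q < h p + h q)}"
    define f where "f = (\<lambda>(p, q). if p = q then h p else h p + h q - \<rho> p q)"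
    define g where "g = (\<lambda>(p, q). if p = q then - \<delta> p else - (\<delta> p + \<delta> q + \<tau> * cut_sep S p q))"
    have "finite A" by (rule finite_subset[of _ "M \<times> M"]) (auto simp: A_def fin)
    moreover have "0 < f x" if "x \<in> A" for x
      using that pos by (auto simp: A_def f_def)
    ultimately obtain \<epsilon> where \<epsilon>: "\<epsilon> > 0" "\<forall>x\<in>A. \<epsilon> * g x \<le> f x"
      using uniform_positive_step by metis
    define k where "k p = h p + \<epsilon> * \<delta> p" for p
    have "0 \<le> k p" if "p \<in> M" for p
      using \<epsilon>(2)[rule_format, of "(p, p)"] that by (simp add: A_def f_def g_def k_def)
    moreover have "\<rho> p q \<le> k p + k q + \<epsilon> * \<tau> * cut_sep S p q"
      if "p \<in> M" "q \<in> M" "p \<noteq> q" for p q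
    proof (cases "\<rho> p q < h p + h q")
      case True
      then show ?thesis using \<epsilon>(2)[rule_format, of "(p, q)"] that
        by (simp add: A_def f_def g_def k_def algebra_simps)
    next
      case False
      with cover[OF that] have eq: "\<rho> p q = h p + h q" by simp
      have "0 \<le> \<epsilon> * (\<delta> p + \<delta> q + \<tau> * cut_sep S p q)"
        using \<epsilon>(1) tight[OF that eq] by simp
      then show ?thesis using eq by (simp add: k_def algebra_simps)
    qed
    ultimately have "sum h M \<le> sum k M + \<epsilon> * \<tau>"
      using \<tau> \<epsilon>(1) by (intro opt) auto
    also have "\<dots> = sum h M + \<epsilon> * (sum \<delta> M + \<tau>)"
      by (simp add: k_def sum.distrib sum_distrib_left algebra_simps)
    finally show ?thesis using \<epsilon>(1) by (simp add: zero_le_mult_iff)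
  qed
  obtain a where a: "a \<in> M" using card by fastforce
  define B where "B = M - {a}"
  have B: "finite B" "3 \<le> card B" using card fin a by (auto simp: B_def)
  have "\<exists>\<eta> :: 'a \<Rightarrow> real. \<forall>p\<in>M. \<forall>q\<in>M. p \<noteq> q \<longrightarrow> \<rho> p q = h p + h q \<longrightarrow>
           \<eta> p + \<eta> q = of_bool ({p, q} = {a, b})" if "b \<in> B" for b
    using that a by (intro tight_pairs_dual[OF met fin inc]) (auto simp: B_def)
  then obtain \<eta> :: "'a \<Rightarrow> 'a \<Rightarrow> real" where \<eta>: "\<And>b p q. b \<in> B \<Longrightarrow> p \<in> M \<Longrightarrow> q \<in> M \<Longrightarrow> p \<noteq> q \<Longrightarrow>
      \<rho> p q = h p + h q \<Longrightarrow> \<eta> b p + \<eta> b q = of_bool ({p, q} = {a, b})"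
    by metis
  have one: "(\<Sum>i\<in>M. of_bool (i = j) :: real) = 1" if "j \<in> M" for j
    using fin that by (subst sum.remove[of _ j]) auto
  have large: "1 / 2 \<le> sum (\<eta> b) M" if b: "b \<in> B" for b
  proof -
    have bM: "b \<in> M" "b \<noteq> a" using b by (auto simp: B_def)
    \<comment> \<open>On tight pairs, this perturbation cancels the distance between the centres exactly:
      \<open>\<delta> p + \<delta> q\<close> is \<open>- 1\<close> if \<open>{a, b}\<close> separates \<open>p\<close> and \<open>q\<close>, and \<open>0\<close> otherwise.\<close>
    define \<delta> where "\<delta> i = 2 * \<eta> b i - of_bool (i = a) - of_bool (i = b)" for i
    have "0 \<le> sum \<delta> M + 1"
    proof (rule perturb[where S = "{a, b}"])
      fix p q assume pq: "p \<in> M" "q \<in> M" "p \<noteq> q" "\<rho> p q = h p + h q"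
      then show "0 \<le> \<delta> p + \<delta> q + 1 * cut_sep {a, b} p q"
        using \<eta>[OF b pq] bM(2) by (auto simp: \<delta>_def cut_sep_def doubleton_eq_iff split: if_splits)
    qed simp
    moreover have "sum \<delta> M = 2 * sum (\<eta> b) M - 2"
      using one[OF a] one[OF bM(1)] by (simp add: \<delta>_def sum_subtractf sum_distrib_left)
    ultimately show ?thesis by simp
  qed
  \<comment> \<open>The indicator of \<open>a\<close> minus all the dual vectors vanishes on every tight pair.\<close>
  have "0 \<le> (\<Sum>i\<in>M. of_bool (i = a) - (\<Sum>b\<in>B. \<eta> b i)) + 0"
  proof (rule perturb[where S = "{}"])
    fix p q assume pq: "p \<in> M" "q \<in> M" "p \<noteq> q" "\<rho> p q = h p + h q"
    have "(\<Sum>b\<in>B. \<eta> b p) + (\<Sum>b\<in>B. \<eta> b q) = (\<Sum>b\<in>B. of_bool ({p, q} = {a, b}))"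
      unfolding sum.distrib[symmetric] using \<eta> pq by (intro sum.cong) auto
    also have "\<dots> = of_bool (p = a) + of_bool (q = a)"
    proof -
      consider "p = a" "q \<in> B" | "q = a" "p \<in> B" | "p \<noteq> a" "q \<noteq> a"
        using pq by (auto simp: B_def)
      then show ?thesis
      proof cases
        case 1
        then have "(\<Sum>b\<in>B. of_bool ({p, q} = {a, b}) :: real) = (\<Sum>b\<in>{q}. 1)"
          using B pq by (intro sum.mono_neutral_cong_right) (auto simp: doubleton_eq_iff)
        then show ?thesis using 1 pq by simp
      next
        case 2
        then have "(\<Sum>b\<in>B. of_bool ({p, q} = {a, b}) :: real) = (\<Sum>b\<in>{p}. 1)"
          using B pq by (intro sum.mono_neutral_cong_right) (auto simp: doubleton_eq_iff)
        then show ?thesis using 2 pq by simp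
      next
        case 3
        then show ?thesis by (auto simp: doubleton_eq_iff)
      qed
    qed
    finally show "0 \<le> of_bool (p = a) - (\<Sum>b\<in>B. \<eta> b p) + (of_bool (q = a) - (\<Sum>b\<in>B. \<eta> b q))
        + 0 * cut_sep {} p q" by simp
  qed simp
  also have "\<dots> = 1 - (\<Sum>b\<in>B. sum (\<eta> b) M)"
    using one[OF a] by (simp add: sum_subtractf) (rule sum.swap)
  finally have "(\<Sum>b\<in>B. sum (\<eta> b) M) \<le> 1" by simp
  moreover have "real (card B) * (1 / 2) \<le> (\<Sum>b\<in>B. sum (\<eta> b) M)"
    using large by (intro sum_bounded_below) auto
  ultimately show False using B(2) by simp
qed

section \<open>Double stars are fillings\<close>

lemma cut_dist_singletons:
  assumes "finite M" and "x \<noteq> y"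
  shows "cut_dist M (\<lambda>p. {p}) k x y
       = (if x \<in> M then k x else 0) + (if y \<in> M then k y else 0)"
proof -
  have "cut_dist M (\<lambda>p. {p}) k x y
      = (\<Sum>i\<in>M. (if i = x then k i else 0) + (if i = y then k i else 0))"
    unfolding cut_dist_def using assms(2) by (intro sum.cong) (auto simp: cut_sep_def)
  then show ?thesis using assms(1) by (simp add: sum.distrib)
qed

lemma double_star_filling:
  fixes M :: "'a::infinite set"
  assumes fin: "finite M" and t: "0 \<le> t"
    and k: "\<And>p. p \<in> M \<Longrightarrow> 0 \<le> k p"
    and self: "\<And>p. p \<in> M \<Longrightarrow> \<rho> p p \<le> 0"
    and cover: "\<And>p q. p \<in> M \<Longrightarrow> q \<in> M \<Longrightarrow> p \<noteq> q \<Longrightarrow> \<rho> p q \<le> k p + k q + t * cut_sep S p q"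
  shows "\<exists>V E w. is_filling M \<rho> V E w \<and> graph_weight E w = sum k M + t"
proof -
  obtain c where c: "c \<notin> M" using ex_new_if_finite[OF infinite_UNIV fin] by blast
  obtain d where d: "d \<notin> insert c M"
    using ex_new_if_finite[OF infinite_UNIV, of "insert c M"] fin by blast
  define hub where "hub p = (if p \<in> S then c else d)" for p
  define V where "V = insert c (insert d M)"
  define F where "F = (\<lambda>p. {p, hub p}) ` M"
  define E where "E = insert {c, d} F"
  define w where "w e = (if e = {c, d} then t else sum k (e \<inter> M))" for e
  have hub: "hub p \<notin> M" for p using c d by (simp add: hub_def)
  have notin: "{c, d} \<notin> F" using c d by (auto simp: F_def doubleton_eq_iff)
  have w_spoke: "w {p, hub p} = k p" if "p \<in> M" for p
  proof -
    have "{p, hub p} \<noteq> {c, d}" using that c d by (auto simp: doubleton_eq_iff)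
    moreover have "{p, hub p} \<inter> M = {p}" using that hub by auto
    ultimately show ?thesis by (simp add: w_def)
  qed
  define D where "D x y = cut_dist M (\<lambda>p. {p}) k x y + t * cut_sep (insert c (S \<inter> M)) x y" for x y
  have D_commute: "D x y = D y x" for x y
    by (simp add: D_def cut_dist_commute cut_sep_commute)
  have D_spoke: "D p (hub p) \<le> k p" if "p \<in> M" for p
  proof -
    have "p \<noteq> hub p" using hub that by metis
    then show ?thesis using that c d hub[of p]
      by (auto simp: D_def cut_dist_singletons fin hub_def cut_sep_def split: if_splits)
  qed
  have D_bridge: "D c d \<le> t"
    using c d t by (auto simp: D_def cut_dist_singletons fin cut_sep_def)
  have "is_filling M \<rho> V E w"
  proof (rule filling_criterion[where c = c and D = D])
    show "fin_graph V E"
      using fin c d by (auto simp: fin_graph_def V_def E_def F_def hub_def)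
    show "M \<subseteq> V" "c \<in> V" by (auto simp: V_def)
    have cd: "linked E c d" by (intro linked_edge) (simp add: E_def)
    show "linked E c v" if "v \<in> V" for v
    proof -
      have "linked E c v" if v: "v \<in> M"
      proof -
        have "linked E c (hub v)" using cd by (auto simp: hub_def)
        moreover have "linked E (hub v) v"
          using v by (intro linked_edge) (auto simp: E_def F_def insert_commute)
        ultimately show ?thesis by (rule linked_trans)
      qed
      then show ?thesis using cd that by (auto simp: V_def)
    qed
    show "0 \<le> w e" if "e \<in> E" for e
      using t k by (auto simp: w_def intro!: sum_nonneg)
    show "D x x \<le> 0" for x by (simp add: D_def)
    show "D x z \<le> D x y + D y z" for x y z
      using cut_dist_triangle[of M k "\<lambda>p. {p}" x z y] k
        mult_left_mono[OF cut_sep_triangle[of "insert c (S \<inter> M)" x z y] t]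
      by (simp add: D_def distrib_left)
    show "D x y \<le> w {x, y}" if xy: "{x, y} \<in> E" for x y
    proof -
      consider "{x, y} = {c, d}" | p where "p \<in> M" "{x, y} = {p, hub p}"
        using xy unfolding E_def F_def by blast
      then show ?thesis
      proof cases
        case 1
        then show ?thesis using D_bridge D_commute by (auto simp: w_def doubleton_eq_iff)
      next
        case 2
        then have "D x y \<le> k p"
          using D_spoke[of p] D_commute by (auto simp: doubleton_eq_iff)
        then show ?thesis using w_spoke 2 by simp
      qed
    qed
    show "\<rho> p q \<le> D p q" if "p \<in> M" "q \<in> M" for p q
    proof (cases "p = q")
      case True
      then show ?thesis using self that by (simp add: D_def)
    next
      case False
      have "cut_sep (insert c (S \<inter> M)) p q = cut_sep S p q"
        using that c by (auto simp: cut_sep_def)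
      then show ?thesis using cover[OF that False] that False
        by (simp add: D_def cut_dist_singletons fin)
    qed
  qed
  moreover have "graph_weight E w = sum k M + t"
  proof -
    have "inj_on (\<lambda>p. {p, hub p}) M" using hub by (auto simp: inj_on_def doubleton_eq_iff)
    then have "sum w F = sum k M"
      unfolding F_def using w_spoke by (simp add: sum.reindex)
    moreover have "finite F" using fin by (simp add: F_def)
    ultimately show ?thesis using notin by (simp add: graph_weight_def E_def w_def)
  qed
  ultimately show ?thesis by blast
qed

section \<open>Trees as families of cuts\<close>

text \<open>
  The metric structure of a tree, kept as a family of cuts: \<open>side e\<close> is one of the two sides into
  which the edge \<open>e\<close> divides the vertices, so that \<open>e\<close> is the only edge between \<open>side e\<close>
  and its complement. Which of the two sides is chosen does not matter. Outside of \<open>V\<close> nothing is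
  required of \<open>side e\<close>.
\<close>

locale tree_cuts =
  fixes V :: "'a set" and E :: "'a set set" and side :: "'a set \<Rightarrow> 'a set"
  assumes graph: "fin_graph V E"
    and linked: "u \<in> V \<Longrightarrow> v \<in> V \<Longrightarrow> linked E u v"
    and crossing: "e \<in> E \<Longrightarrow> {x, y} \<in> E \<Longrightarrow> (x \<in> side e) \<noteq> (y \<in> side e) \<longleftrightarrow> {x, y} = e"

lemma tree_has_cuts:
  assumes G: "fin_graph V E" and T: "is_tree V E"
  shows "\<exists>side. tree_cuts V E side"
proof -
  define root :: "'a set \<Rightarrow> 'a" where "root e = (SOME u. u \<in> e)" for e
  define side where "side e = {x. linked (E - {e}) (root e) x}" for e
  have bridge: "\<not> linked (E - {{x, y}}) x y" if "{x, y} \<in> E" for x y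
  proof
    assume l: "linked (E - {{x, y}}) x y"
    have "{x, y} \<in> [V]\<^bsup>2\<^esup>" using that G unfolding fin_graph_def by blast
    then have xy: "x \<in> V" "x \<noteq> y" by auto
    obtain p where p: "graph_path V (E - {{x, y}}) p" "hd p = x" "last p = y"
      using path_if_linked[OF l xy(1)] G by (auto simp: fin_graph_def)
    have "3 \<le> length p"
    proof (rule ccontr)
      assume "\<not> 3 \<le> length p"
      then consider "p = []" | a where "p = [a]" | a b where "p = [a, b]"
        by (cases p; cases "tl p"; cases "tl (tl p)") auto
      then show False using p xy by cases (auto simp: graph_path_def)
    qed
    moreover have "graph_path V E p"
      using p(1) by (auto simp: graph_path_def elim: successively_mono)
    ultimately show False
      using T p that by (auto simp: is_tree_def graph_acyclic_def insert_commute)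
  qed
  have "tree_cuts V E side"
  proof
    show "fin_graph V E" by (rule G)
    show "linked E u v" if uv: "u \<in> V" "v \<in> V" for u v
    proof -
      obtain p where "graph_path V E p" "hd p = u" "last p = v"
        using T uv by (fastforce simp: is_tree_def graph_connected_def paths_between_def)
      then show ?thesis using linked_if_path by (auto simp: graph_path_def)
    qed
    show "(x \<in> side e) \<noteq> (y \<in> side e) \<longleftrightarrow> {x, y} = e" if e: "e \<in> E" "{x, y} \<in> E" for e x y
    proof (cases "{x, y} = e")
      case False
      then have "linked (E - {e}) x y" using e by (intro linked_edge) auto
      then show ?thesis using False unfolding side_def by (auto intro: linked_trans linked_sym)
    next
      case True
      then have "root e \<in> {x, y}" unfolding root_def by (metis insertI1 someI_ex)
      moreover have "\<not> linked (E - {e}) x y" "\<not> linked (E - {e}) y x"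
        using bridge[of x y] bridge[of y x] e True by (auto simp: insert_commute)
      ultimately show ?thesis using True by (auto simp: side_def)
    qed
  qed
  then show ?thesis by blast
qed

context tree_cuts
begin

lemma edge_in_V:
  assumes "{x, y} \<in> E"
  shows "x \<in> V \<and> y \<in> V \<and> x \<noteq> y"
proof -
  have "{x, y} \<in> [V]\<^bsup>2\<^esup>" using assms graph unfolding fin_graph_def by blast
  then show ?thesis by simp
qed

lemma edge_doubleton:
  assumes "e \<in> E"
  obtains x y where "e = {x, y}"
proof -
  have "e \<in> [V]\<^bsup>2\<^esup>" using graph assms unfolding fin_graph_def by blast
  then show ?thesis using that by (elim nsets2_E)
qed

lemma edge_eq:
  assumes "e \<in> E" and "u \<in> e"
  shows "\<exists>v. e = {u, v}"
proof -
  obtain x y where "e = {x, y}" using edge_doubleton[OF assms(1)] .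
  then show ?thesis using assms(2) by auto
qed

lemma finite_E: "finite E"
proof -
  have "finite V" and "E \<subseteq> [V]\<^bsup>2\<^esup>" using graph unfolding fin_graph_def by auto
  then show ?thesis by (intro finite_subset[OF \<open>E \<subseteq> [V]\<^bsup>2\<^esup>\<close>] finite_imp_finite_nsets)
qed

lemma cut_dist_edge:
  assumes "{x, y} \<in> E"
  shows "cut_dist E side w x y = w {x, y}"
proof -
  have "cut_dist E side w x y = (\<Sum>e\<in>E. if e = {x, y} then w e else 0)"
    unfolding cut_dist_def using assms crossing by (intro sum.cong) (auto simp: cut_sep_def)
  then show ?thesis using assms finite_E by simp
qed

lemma same_side_if_path_avoids:
  assumes "successively (\<lambda>x y. {x, y} \<in> E) p" and "p \<noteq> []" and "x \<notin> set p"
    and "e \<in> E" and "x \<in> e"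
  shows "hd p \<in> side e \<longleftrightarrow> last p \<in> side e"
  using assms(1-3)
proof (induction p rule: induct_list012)
  case (3 y z zs)
  then have yz: "{y, z} \<in> E" "{y, z} \<noteq> e" using assms(5) by auto
  then have "y \<in> side e \<longleftrightarrow> z \<in> side e" using crossing[OF assms(4) yz(1)] by simp
  then show ?case using 3 by simp
qed auto

text \<open>
  A path has no repeated vertex, so it uses an edge at most once, and it uses exactly the
  edges whose cuts separate its ends.
\<close>

lemma path_weight_eq_cut_dist:
  assumes "graph_path V E p"
  shows "path_weight w p = cut_dist E side w (hd p) (last p)"
proof -
  have "p \<noteq> []" "distinct p" "successively (\<lambda>x y. {x, y} \<in> E) p"
    using assms by (auto simp: graph_path_def)
  then show ?thesis
  proof (induction p rule: induct_list012)
    case (3 x y zs)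
    let ?l = "last (y # zs)"
    have e: "{x, y} \<in> E" using 3 by auto
    have same: "y \<in> side {x, y} \<longleftrightarrow> ?l \<in> side {x, y}"
      using same_side_if_path_avoids[of "y # zs" x "{x, y}"] 3 e by auto
    have "cut_sep (side f) x ?l = cut_sep (side f) x y + cut_sep (side f) y ?l" if "f \<in> E" for f
      using same crossing[OF that e] by (cases "f = {x, y}") (auto simp: cut_sep_def)
    then have "cut_dist E side w x ?l = cut_dist E side w x y + cut_dist E side w y ?l"
      by (simp add: cut_dist_def distrib_left sum.distrib)
    moreover have "path_weight w (y # zs) = cut_dist E side w y ?l" using 3 by auto
    ultimately show ?case using cut_dist_edge[OF e] by (simp add: path_weight_Cons)
  qed auto
qed

lemma graph_dist_le_cut_dist:
  assumes "u \<in> V" and "v \<in> V"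
  shows "graph_dist V E w u v \<le> cut_dist E side w u v"
proof -
  obtain p where p: "graph_path V E p" "hd p = u" "last p = v"
    using path_if_linked[OF linked[OF assms] assms(1)] graph by (auto simp: fin_graph_def)
  then have "graph_dist V E w u v \<le> path_weight w p"
    unfolding graph_dist_def using graph
    by (intro Min_le finite_imageI finite_paths_between) (auto simp: fin_graph_def paths_between_def)
  then show ?thesis using path_weight_eq_cut_dist[OF p(1)] p by simp
qed

text \<open>
  Additivity of the tree distance at an end \<open>u\<close> of an edge \<open>e\<close> that separates \<open>s\<close> from \<open>t\<close>. Otherwise
  some cut \<open>side f\<close> would separate \<open>u\<close> from both \<open>s\<close> and \<open>t\<close>, so that the cuts of \<open>e\<close> and \<open>f\<close> would
  have four non-empty intersections, which is impossible in a tree.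
\<close>

lemma cut_dist_via_separating_edge:
  assumes e: "e \<in> E" "u \<in> e" and st: "s \<in> V" "t \<in> V" "(s \<in> side e) \<noteq> (t \<in> side e)"
  shows "cut_dist E side w s t = cut_dist E side w s u + cut_dist E side w u t"
proof -
  have "cut_sep (side f) s t = cut_sep (side f) s u + cut_sep (side f) u t" if f: "f \<in> E" for f
  proof (rule ccontr)
    assume "\<not> ?thesis"
    then have sides: "(s \<in> side f) = (t \<in> side f)" "(u \<in> side f) \<noteq> (s \<in> side f)"
      by (cases "s \<in> side f"; cases "t \<in> side f"; cases "u \<in> side f"; simp add: cut_sep_def)+
    then have "f \<noteq> e" using st(3) by blast
    obtain v where v: "e = {u, v}" using edge_eq[OF e] by blast
    have vf: "(v \<in> side f) = (u \<in> side f)"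
      using crossing[OF f, of u v] v e \<open>f \<noteq> e\<close> by auto
    obtain g g' where g: "f = {g, g'}"
      using edge_doubleton[OF f] .
    have ge: "(g' \<in> side e) = (g \<in> side e)"
      using crossing[OF e(1), of g g'] g f \<open>f \<noteq> e\<close> by auto
    \<comment> \<open>The part beyond \<open>f\<close> on the side of \<open>e\<close> that contains no end of \<open>f\<close>: no edge leaves it.\<close>
    define Q where "Q = {x. (x \<in> side f) = (s \<in> side f) \<and> (x \<in> side e) \<noteq> (g \<in> side e)}"
    obtain r where r: "r \<in> V" "r \<in> Q" using st sides by (auto simp: Q_def)
    have "u \<in> V" using v e edge_in_V by blast
    moreover have "u \<notin> Q" using sides by (auto simp: Q_def)
    ultimately obtain a b where ab: "{a, b} \<in> E" "a \<in> Q" "b \<notin> Q"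
      using linked_crossing_edge[OF linked r(2)] r by blast
    then have "(a \<in> side f) \<noteq> (b \<in> side f) \<or> (a \<in> side e) \<noteq> (b \<in> side e)"
      by (auto simp: Q_def)
    then have "{a, b} = f \<or> {a, b} = e" using crossing[OF f ab(1)] crossing[OF e(1) ab(1)] by blast
    then show False
    proof
      assume "{a, b} = f"
      then have "(a \<in> side e) = (g \<in> side e)" using g ge by (auto simp: doubleton_eq_iff)
      then show False using ab by (auto simp: Q_def)
    next
      assume "{a, b} = e"
      then have "(a \<in> side f) = (u \<in> side f)" using v vf by (auto simp: doubleton_eq_iff)
      then show False using ab sides by (auto simp: Q_def)
    qed
  qed
  then show ?thesis by (simp add: cut_dist_def distrib_left sum.distrib)
qed

text \<open>
  The remaining lemmas about cuts concern the clusters of vertices linked by edges of weight zero.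
  They make it unnecessary to contract these edges.
\<close>

lemma zero_linked_same_side:
  fixes w :: "'a set \<Rightarrow> real"
  assumes "linked {e \<in> E. w e = 0} x y" and "f \<in> E" and "w f \<noteq> 0"
  shows "x \<in> side f \<longleftrightarrow> y \<in> side f"
proof (rule ccontr)
  assume "\<not> ?thesis"
  then obtain a b where "{a, b} \<in> {e \<in> E. w e = 0}" "(a \<in> side f) = (x \<in> side f)"
      "(b \<in> side f) \<noteq> (x \<in> side f)"
    using linked_crossing_edge[OF assms(1), of "{z. (z \<in> side f) = (x \<in> side f)}"] by auto
  then show False using crossing[OF assms(2), of a b] assms(3) by auto
qed

lemma zero_linked_cut_dist:
  fixes w w' :: "'a set \<Rightarrow> real"
  assumes "linked {e \<in> E. w e = 0} x y" and "\<And>e. e \<in> E \<Longrightarrow> w e = 0 \<Longrightarrow> w' e = 0"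
  shows "cut_dist E side w' x y = 0"
  unfolding cut_dist_def
proof (rule sum.neutral, rule ballI)
  fix e assume "e \<in> E"
  then show "w' e * cut_sep (side e) x y = 0"
    using zero_linked_same_side[OF assms(1)] assms(2) by (cases "w e = 0") (auto simp: cut_sep_def)
qed

section \<open>Local structure at a boundary vertex\<close>

text \<open>
  Two edges of positive weight leave the zero cluster of a boundary vertex \<open>b\<close>. Detach both of them,
  attach them to a new vertex \<open>z\<close> at distance \<open>\<epsilon>\<close> from \<open>b\<close>, and shorten each by \<open>\<epsilon>\<close>: the total weight
  drops by \<open>\<epsilon>\<close>. Only distances between the two branches decrease. The corresponding pairs are not
  tight, since \<open>b\<close> lies between their points and the triangle inequality for \<open>\<rho>\<close> is strict; so for
  small \<open>\<epsilon>\<close> the result is again a filling.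
\<close>

lemma split_boundary_vertex:
  fixes w :: "'a set \<Rightarrow> real"
  assumes inf: "infinite (UNIV :: 'a set)"
    and w: "\<And>e. e \<in> E \<Longrightarrow> 0 \<le> w e"
    and M: "M \<subseteq> V" "finite M"
    and self: "\<And>p. p \<in> M \<Longrightarrow> \<rho> p p \<le> 0"
    and strict: "\<And>p q r. p \<in> M \<Longrightarrow> q \<in> M \<Longrightarrow> r \<in> M \<Longrightarrow> p \<noteq> q \<Longrightarrow> p \<noteq> r \<Longrightarrow> q \<noteq> r \<Longrightarrow>
                   \<rho> p q < \<rho> p r + \<rho> r q"
    and fill: "\<And>p q. p \<in> M \<Longrightarrow> q \<in> M \<Longrightarrow> \<rho> p q \<le> cut_dist E side w p q"
    and b: "b \<in> M"
    and e1: "e1 \<in> E" "0 < w e1" "u1 \<in> e1" "linked {e \<in> E. w e = 0} b u1"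
    and e2: "e2 \<in> E" "0 < w e2" "u2 \<in> e2" "linked {e \<in> E. w e = 0} b u2"
    and ne: "e1 \<noteq> e2"
  shows "\<exists>V' E' w'. is_filling M \<rho> V' E' w' \<and> graph_weight E' w' < graph_weight E w"
proof -
  obtain v1 where v1: "e1 = {u1, v1}" using edge_eq e1 by blast
  obtain v2 where v2: "e2 = {u2, v2}" using edge_eq e2 by blast
  have inV: "b \<in> V" "u1 \<in> V" "v1 \<in> V" "u2 \<in> V" "v2 \<in> V"
    using b M e1(1) e2(1) v1 v2 edge_in_V by blast+
  define far1 where "far1 = {x. (x \<in> side e1) \<noteq> (b \<in> side e1)}"
  define far2 where "far2 = {x. (x \<in> side e2) \<noteq> (b \<in> side e2)}"
  have near: "b \<notin> far1" "b \<notin> far2" "u1 \<notin> far1" "u1 \<notin> far2" "u2 \<notin> far1" "u2 \<notin> far2"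
    using zero_linked_same_side[OF e1(4) e1(1)] zero_linked_same_side[OF e1(4) e2(1)]
      zero_linked_same_side[OF e2(4) e1(1)] zero_linked_same_side[OF e2(4) e2(1)] e1(2) e2(2)
    by (auto simp: far1_def far2_def)
  have far1_iff: "(x \<in> far1) = (y \<in> far1) \<longleftrightarrow> {x, y} \<noteq> e1" if "{x, y} \<in> E" for x y
    using crossing[OF e1(1) that] by (auto simp: far1_def)
  have far2_iff: "(x \<in> far2) = (y \<in> far2) \<longleftrightarrow> {x, y} \<noteq> e2" if "{x, y} \<in> E" for x y
    using crossing[OF e2(1) that] by (auto simp: far2_def)
  have far: "v1 \<in> far1" "v1 \<notin> far2" "v2 \<in> far2" "v2 \<notin> far1"
    using far1_iff[of u1 v1] far2_iff[of u1 v1] far1_iff[of u2 v2] far2_iff[of u2 v2]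
      near e1(1) e2(1) v1 v2 ne by auto
  have disj: "x \<notin> far2" if x: "x \<in> V" "x \<in> far1" for x
  proof
    assume "x \<in> far2"
    then obtain a a' where a: "{a, a'} \<in> E" "a \<in> far1 \<inter> far2" "a' \<notin> far1 \<inter> far2"
      using linked_crossing_edge[OF linked[OF x(1) inV(1)], of "far1 \<inter> far2"] x near by auto
    then have "{a, a'} = e1 \<or> {a, a'} = e2" using far1_iff[OF a(1)] far2_iff[OF a(1)] by blast
    then show False using a(2) v1 v2 near far by (auto simp: doubleton_eq_iff)
  qed
  have "\<exists>\<epsilon>0>0. \<forall>x\<in>{(p, q). p \<in> M \<and> q \<in> M \<and> \<rho> p q < cut_dist E side w p q}.
      \<epsilon>0 * 2 \<le> (case x of (p, q) \<Rightarrow> cut_dist E side w p q - \<rho> p q)"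
    by (rule uniform_positive_step) (auto intro: finite_subset[of _ "M \<times> M"] simp: M)
  then obtain \<epsilon>0 where \<epsilon>0: "\<epsilon>0 > 0" "\<And>p q. p \<in> M \<Longrightarrow> q \<in> M \<Longrightarrow> \<rho> p q < cut_dist E side w p q \<Longrightarrow>
      \<epsilon>0 * 2 \<le> cut_dist E side w p q - \<rho> p q" by auto
  define \<epsilon> where "\<epsilon> = min \<epsilon>0 (min (w e1) (w e2))"
  have \<epsilon>: "\<epsilon> > 0" "\<epsilon> \<le> \<epsilon>0" "\<epsilon> \<le> w e1" "\<epsilon> \<le> w e2" using \<epsilon>0 e1 e2 by (auto simp: \<epsilon>_def)
  obtain z where z: "z \<notin> V" using ex_new_if_finite[OF inf] graph by (auto simp: fin_graph_def)
  define wr where "wr e = (if e = e1 \<or> e = e2 then w e - \<epsilon> else w e)" for e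
  \<comment> \<open>For all cuts but the new one, the vertex \<open>z\<close> behaves like a copy of \<open>b\<close>. The new cut \<open>B\<close>, of
    weight \<open>\<epsilon>\<close>, collects \<open>z\<close> and the two branches.\<close>
  define \<phi> where "\<phi> x = (if x = z then b else x)" for x
  define B where "B = insert z (far1 \<union> far2)"
  define D where "D x y = cut_dist E side wr (\<phi> x) (\<phi> y) + \<epsilon> * cut_sep B x y" for x y
  define V' where "V' = insert z V"
  define E0 where "E0 = E - {e1, e2}"
  define E' where "E' = E0 \<union> {{z, v1}, {z, v2}, {z, b}}"
  define w' where "w' e = (if e = {z, v1} then w e1 - \<epsilon> else if e = {z, v2} then w e2 - \<epsilon>
      else if e = {z, b} then \<epsilon> else w e)" for e
  have zne: "z \<noteq> b" "z \<noteq> v1" "z \<noteq> v2" "z \<noteq> u1" "z \<noteq> u2" using z inV by auto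
  have vne: "v1 \<noteq> v2" "v1 \<noteq> b" "v2 \<noteq> b" using far near by auto
  have spokes: "{z, v1} \<noteq> {z, v2}" "{z, v1} \<noteq> {z, b}" "{z, v2} \<noteq> {z, b}"
    using vne zne by (auto simp: doubleton_eq_iff)
  have z_notin: "{z, x} \<notin> E" for x using edge_in_V z by blast
  have wr: "0 \<le> wr e" if "e \<in> E" for e using w that \<epsilon> by (auto simp: wr_def)
  have D_commute: "D x y = D y x" for x y
    by (simp add: D_def cut_dist_commute cut_sep_commute)
  have spoke: "D z v \<le> wr {u, v}"
    if "linked {e \<in> E. w e = 0} b u" "{u, v} \<in> E" "v \<in> far1 \<union> far2" "v \<noteq> z" for u v
  proof -
    have "cut_dist E side wr b u = 0"
      using that(1) e1(2) e2(2) by (intro zero_linked_cut_dist[where w = w]) (auto simp: wr_def)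
    moreover have "cut_dist E side wr u v = wr {u, v}" by (rule cut_dist_edge[OF that(2)])
    moreover have "cut_sep B z v = 0" using that by (auto simp: B_def cut_sep_def)
    ultimately show ?thesis
      using cut_dist_triangle[of E wr side b v u] wr that by (simp add: D_def \<phi>_def)
  qed
  have "is_filling M \<rho> V' E' w'"
  proof (rule filling_criterion[where c = b and D = D])
    have E0: "E0 \<subseteq> [V']\<^bsup>2\<^esup>" and "finite V'"
      using graph nsets_mono[of V V' 2] unfolding fin_graph_def E0_def V'_def by auto
    then show "fin_graph V' E'"
      using inV zne by (auto simp: fin_graph_def E'_def V'_def)
    show "M \<subseteq> V'" "b \<in> V'" using M b by (auto simp: V'_def)
    have bz: "linked E' b z" by (rule linked_edge) (auto simp: E'_def insert_commute)
    have zero: "linked E' b u" if "linked {e \<in> E. w e = 0} b u" for u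
      using that e1(2) e2(2)
      by (elim linked_mono) (auto intro!: linked_edge simp: E'_def E0_def)
    have l1: "linked E' u1 v1" and l2: "linked E' u2 v2"
      using zero[OF e1(4)] zero[OF e2(4)] bz linked_edge[of z v1 E'] linked_edge[of z v2 E']
      by (auto simp: E'_def intro: linked_sym linked_trans)
    show "linked E' b v" if "v \<in> V'" for v
    proof (cases "v = z")
      case False
      then have "linked E b v" using that linked inV by (auto simp: V'_def)
      then show ?thesis
      proof (rule linked_mono)
        fix x y assume xy: "{x, y} \<in> E"
        show "linked E' x y"
        proof (cases "{x, y} \<in> E0")
          case True
          then show ?thesis by (intro linked_edge) (simp add: E'_def)
        next
          case False
          then show ?thesis
            using xy l1 l2 v1 v2 linked_sym by (fastforce simp: E0_def doubleton_eq_iff)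
        qed
      qed
    qed (use bz in simp)
    show "0 \<le> w' e" if "e \<in> E'" for e
      using that w \<epsilon> by (auto simp: w'_def E'_def E0_def)
    show "D x x \<le> 0" for x by (simp add: D_def)
    show "D x y \<le> D x t + D t y" for x y t
      using cut_dist_triangle[of E wr side "\<phi> x" "\<phi> y" "\<phi> t"] wr
        mult_left_mono[OF cut_sep_triangle[of B x y t], of \<epsilon>] \<epsilon>(1)
      by (simp add: D_def distrib_left)
    show "D x y \<le> w' {x, y}" if xy: "{x, y} \<in> E'" for x y
    proof -
      consider "{x, y} \<in> E0" | v where "{x, y} = {z, v}" "{z, v} \<in> {{z, v1}, {z, v2}, {z, b}}"
        using xy unfolding E'_def by blast
      then show ?thesis
      proof cases
        case 1
        then have xy: "{x, y} \<in> E" "{x, y} \<noteq> e1" "{x, y} \<noteq> e2" by (auto simp: E0_def)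
        then have "x \<noteq> z" "y \<noteq> z" using edge_in_V z by blast+
        moreover have "cut_sep B x y = 0"
          using far1_iff[OF xy(1)] far2_iff[OF xy(1)] xy calculation
          by (auto simp: B_def cut_sep_def)
        moreover have "w' {x, y} = w {x, y}"
          using z_notin xy(1) by (auto simp: w'_def)
        ultimately show ?thesis
          using xy by (simp add: D_def \<phi>_def cut_dist_edge wr_def)
      next
        case 2
        have "D z v1 \<le> w e1 - \<epsilon>" "D z v2 \<le> w e2 - \<epsilon>"
          using spoke[OF e1(4), of v1] spoke[OF e2(4), of v2] e1 e2 v1 v2 far zne
          by (auto simp: wr_def)
        moreover have "D z b \<le> \<epsilon>" using \<epsilon>(1) by (simp add: D_def \<phi>_def cut_sep_def)
        moreover have "w' {z, v1} = w e1 - \<epsilon>" "w' {z, v2} = w e2 - \<epsilon>" "w' {z, b} = \<epsilon>"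
          using spokes unfolding w'_def by metis+
        moreover have "v = v1 \<or> v = v2 \<or> v = b" using 2(2) by (simp add: doubleton_eq_iff) blast
        ultimately have "D z v \<le> w' {z, v}" by (elim disjE) simp_all
        moreover have "x = z \<and> y = v \<or> x = v \<and> y = z" using 2(1) by (simp add: doubleton_eq_iff)
        ultimately show ?thesis using 2(1) D_commute[of v z] by (elim disjE) simp_all
      qed
    qed
    show "\<rho> p q \<le> D p q" if pq: "p \<in> M" "q \<in> M" for p q
    proof (cases "p = q")
      case True
      then show ?thesis using self pq by (simp add: D_def)
    next
      case False
      have V: "p \<in> V" "q \<in> V" "p \<noteq> z" "q \<noteq> z" using pq M z by auto
      have "cut_dist E side wr p q = (\<Sum>e\<in>E. w e * cut_sep (side e) p q
          - (if e = e1 then \<epsilon> * cut_sep (side e) p q else 0)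
          - (if e = e2 then \<epsilon> * cut_sep (side e) p q else 0))"
        unfolding cut_dist_def wr_def using ne by (intro sum.cong) (auto simp: left_diff_distrib)
      also have "\<dots> = cut_dist E side w p q - \<epsilon> * cut_sep (side e1) p q - \<epsilon> * cut_sep (side e2) p q"
        using finite_E e1(1) e2(1) by (simp add: cut_dist_def sum_subtractf)
      finally have D: "D p q = cut_dist E side w p q
          + \<epsilon> * (cut_sep B p q - cut_sep (side e1) p q - cut_sep (side e2) p q)"
        using V by (simp add: D_def \<phi>_def algebra_simps)
      show ?thesis
      proof (cases "\<rho> p q < cut_dist E side w p q")
        case True
        have "\<epsilon> * (- 2) \<le> \<epsilon> * (cut_sep B p q - cut_sep (side e1) p q - cut_sep (side e2) p q)"
          using \<epsilon>(1) by (intro mult_left_mono) (auto simp: cut_sep_def)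
        then show ?thesis using D \<epsilon>0(2)[OF pq True] \<epsilon>(2) by linarith
      next
        case False
        then have tight: "\<rho> p q = cut_dist E side w p q" using fill pq by force
        \<comment> \<open>A tight pair separated by one of the two edges has \<open>b\<close> as an end, because \<open>b\<close> is at
          distance zero from that edge.\<close>
        have ends: "p = b \<or> q = b"
          if e: "e \<in> E" "u \<in> e" "(p \<in> side e) \<noteq> (q \<in> side e)" "linked {e \<in> E. w e = 0} b u" for e u
        proof (rule ccontr)
          assume n: "\<not> (p = b \<or> q = b)"
          have "cut_dist E side w b u = 0" "cut_dist E side w u b = 0"
            using zero_linked_cut_dist[OF e(4), of w] by (auto simp: cut_dist_commute)
          then have "cut_dist E side w p b + cut_dist E side w b q
              \<le> cut_dist E side w p u + cut_dist E side w u q"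
            using cut_dist_triangle[of E w side p b u] cut_dist_triangle[of E w side b q u] w by simp
          also have "\<dots> = \<rho> p q"
            using cut_dist_via_separating_edge[OF e(1,2) V(1,2) e(3)] tight by simp
          finally have "\<rho> p b + \<rho> b q \<le> \<rho> p q"
            using fill[OF pq(1) b] fill[OF b pq(2)] by simp
          then show False using strict[OF pq b \<open>p \<noteq> q\<close>] n by auto
        qed
        have "cut_sep (side e1) p q + cut_sep (side e2) p q \<le> cut_sep B p q"
        proof (cases "p = b \<or> q = b")
          case True
          then show ?thesis using V near disj[OF V(1)] disj[OF V(2)]
            by (auto simp: cut_sep_def B_def far1_def far2_def)
        next
          case False
          then show ?thesis
            using ends[OF e1(1,3) _ e1(4)] ends[OF e2(1,3) _ e2(4)] by (auto simp: cut_sep_def)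
        qed
        then show ?thesis using D tight \<epsilon>(1) by simp
      qed
    qed
  qed
  moreover have "graph_weight E' w' < graph_weight E w"
  proof -
    have fE0: "finite E0" using finite_E by (simp add: E0_def)
    have out: "{z, x} \<notin> E0" for x using z_notin by (simp add: E0_def)
    then have "sum w' E0 = sum w E0" by (intro sum.cong) (auto simp: w'_def)
    moreover have "E' = insert {z, v1} (insert {z, v2} (insert {z, b} E0))" by (auto simp: E'_def)
    ultimately have "sum w' E' = w e1 + w e2 - \<epsilon> + sum w E0"
      using fE0 out spokes by (simp add: w'_def)
    also have "sum w E = w e1 + w e2 + sum w E0"
    proof -
      have "E = insert e1 (insert e2 E0)" using e1 e2 by (auto simp: E0_def)
      then have "sum w E = sum w (insert e1 (insert e2 E0))" by simp
      then show ?thesis using fE0 ne by (simp add: E0_def)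
    qed
    then have "w e1 + w e2 - \<epsilon> + sum w E0 < sum w E" using \<epsilon>(1) by simp
    finally show ?thesis by (simp add: graph_weight_def)
  qed
  ultimately show ?thesis by blast
qed

text \<open>
  The assumptions \<open>touch\<close> and \<open>uniq\<close> say that every edge of positive weight has an end in \<open>M\<close>, and that at most
  one edge of positive weight leaves the zero cluster of a point of \<open>M\<close>. Then the tree is metrically a
  star on \<open>M\<close>, the leg of a point being the edge that leaves its cluster.
\<close>

lemma star_weights:
  fixes w :: "'a set \<Rightarrow> real"
  assumes w: "\<And>e. e \<in> E \<Longrightarrow> 0 \<le> w e"
    and M: "M \<subseteq> V" "finite M" "3 \<le> card M"
    and pos: "\<And>p q. p \<in> M \<Longrightarrow> q \<in> M \<Longrightarrow> p \<noteq> q \<Longrightarrow> 0 < cut_dist E side w p q"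
    and touch: "\<And>e. e \<in> E \<Longrightarrow> 0 < w e \<Longrightarrow> e \<inter> M \<noteq> {}"
    and uniq: "\<And>b e1 e2 u1 u2. b \<in> M \<Longrightarrow> e1 \<in> E \<Longrightarrow> 0 < w e1 \<Longrightarrow> u1 \<in> e1 \<Longrightarrow>
        linked {e \<in> E. w e = 0} b u1 \<Longrightarrow> e2 \<in> E \<Longrightarrow> 0 < w e2 \<Longrightarrow> u2 \<in> e2 \<Longrightarrow>
        linked {e \<in> E. w e = 0} b u2 \<Longrightarrow> e1 = e2"
  shows "\<exists>h. (\<forall>p\<in>M. 0 < h p) \<and>
             (\<forall>p\<in>M. \<forall>q\<in>M. p \<noteq> q \<longrightarrow> cut_dist E side w p q \<le> h p + h q) \<and>
             sum h M \<le> graph_weight E w"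
proof -
  define Z where "Z b = {u. linked {e \<in> E. w e = 0} b u}" for b
  have Z_self: "b \<in> Z b" for b by (simp add: Z_def)
  have Z_disj: "x \<notin> Z c" if "b \<in> M" "c \<in> M" "b \<noteq> c" "x \<in> Z b" for b c x
  proof
    assume "x \<in> Z c"
    then have "linked {e \<in> E. w e = 0} b c"
      using that(4) by (auto simp: Z_def intro: linked_trans linked_sym)
    then have "cut_dist E side w b c = 0" by (rule zero_linked_cut_dist)
    then show False using pos that by fastforce
  qed
  have leave_pos: "0 < w {a, a'}" if "{a, a'} \<in> E" "a \<in> Z b" "a' \<notin> Z b" for a a' b
  proof -
    have "w {a, a'} \<noteq> 0"
      using that linked_edge[of a a' "{e \<in> E. w e = 0}"] by (auto simp: Z_def intro: linked_trans)
    then show ?thesis using w[OF that(1)] by simp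
  qed
  have "\<exists>e. e \<in> E \<and> 0 < w e \<and> (\<exists>u v. e = {u, v} \<and> u \<in> Z b \<and> v \<notin> Z b)" if b: "b \<in> M" for b
  proof -
    have "\<not> M \<subseteq> {b}"
    proof
      assume "M \<subseteq> {b}"
      then have "card M \<le> card {b}" by (intro card_mono) auto
      then show False using M(3) by simp
    qed
    then obtain p where p: "p \<in> M" "p \<noteq> b" by blast
    have "linked E b p" using linked b p M by auto
    then obtain a a' where "{a, a'} \<in> E" "a \<in> Z b" "a' \<notin> Z b"
      using linked_crossing_edge[of E b p "Z b"] Z_self Z_disj[OF p(1) b p(2) Z_self] by blast
    then show ?thesis using leave_pos by blast
  qed
  then obtain f where f: "\<And>b. b \<in> M \<Longrightarrow> f b \<in> E" "\<And>b. b \<in> M \<Longrightarrow> 0 < w (f b)"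
      "\<And>b. b \<in> M \<Longrightarrow> \<exists>u v. f b = {u, v} \<and> u \<in> Z b \<and> v \<notin> Z b"
    by metis
  have f_eq: "e = f b" if be: "b \<in> M" "e \<in> E" "0 < w e" "u \<in> e" "u \<in> Z b" for b e u
  proof -
    obtain u' where "u' \<in> f b" "u' \<in> Z b" using f(3)[OF be(1)] by blast
    then show ?thesis using uniq[OF be(1-4) _ f(1,2)] be by (auto simp: Z_def)
  qed
  \<comment> \<open>If two points had a common leg, then no edge would leave the union of their clusters, and there
    would be no third point.\<close>
  have inj: "inj_on f M"
  proof (rule inj_onI, rule ccontr)
    fix b c assume bc: "b \<in> M" "c \<in> M" "f b = f c" "b \<noteq> c"
    obtain u v where uv: "f b = {u, v}" "u \<in> Z b" using f(3)[OF bc(1)] by blast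
    moreover obtain u' v' where "f c = {u', v'}" "u' \<in> Z c" using f(3)[OF bc(2)] by blast
    ultimately have v: "v \<in> Z c" using Z_disj[OF bc(1,2,4)] bc(3) by (auto simp: doubleton_eq_iff)
    have "\<not> M \<subseteq> {b, c}"
    proof
      assume "M \<subseteq> {b, c}"
      then have "card M \<le> card {b, c}" by (intro card_mono) auto
      then show False using M(3) by (simp add: bc)
    qed
    then obtain r where r: "r \<in> M" "r \<noteq> b" "r \<noteq> c" by blast
    have "linked E b r" using linked bc r M by auto
    moreover have "r \<notin> Z b \<union> Z c"
      using Z_disj[OF r(1) bc(1) r(2) Z_self] Z_disj[OF r(1) bc(2) r(3) Z_self] by blast
    ultimately obtain a a' where a: "{a, a'} \<in> E" "a \<in> Z b \<union> Z c" "a' \<notin> Z b \<union> Z c"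
      using linked_crossing_edge[of E b r "Z b \<union> Z c"] Z_self by blast
    then have "0 < w {a, a'}" using leave_pos by blast
    then have "{a, a'} = f b" using f_eq[of _ "{a, a'}" a] bc a by auto
    then show False using uv v a by (auto simp: doubleton_eq_iff)
  qed
  \<comment> \<open>The leg of \<open>r\<close> separates only the cluster of \<open>r\<close> from the rest.\<close>
  have not_sep: "(p \<in> side (f r)) = (q \<in> side (f r))"
    if "p \<in> M" "q \<in> M" "r \<in> M" "p \<noteq> r" "q \<noteq> r" for p q r
  proof -
    have Zside: "(x \<in> side (f r)) = (r \<in> side (f r))" if "x \<in> Z r" for x
      using zero_linked_same_side[of w r x "f r"] f(1,2)[OF \<open>r \<in> M\<close>] that by (auto simp: Z_def)
    obtain u v where uv: "f r = {u, v}" "u \<in> Z r" "v \<notin> Z r" using f(3)[OF \<open>r \<in> M\<close>] by blast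
    have "(x \<in> side (f r)) \<noteq> (r \<in> side (f r))" if x: "x \<in> M" "x \<noteq> r" for x
    proof
      assume same: "(x \<in> side (f r)) = (r \<in> side (f r))"
      \<comment> \<open>No edge leaves \<open>S\<close>: such an edge would be the leg of \<open>r\<close>, which starts in the cluster of
        \<open>r\<close> and ends on the other side of its cut.\<close>
      define S where "S = {y. y \<notin> Z r \<and> (y \<in> side (f r)) = (r \<in> side (f r))}"
      have "x \<in> S" using same Z_disj[OF x(1) \<open>r \<in> M\<close> x(2) Z_self] by (simp add: S_def)
      moreover have "linked E x r" using linked x \<open>r \<in> M\<close> M by auto
      ultimately obtain a a' where a: "{a, a'} \<in> E" "a \<in> S" "a' \<notin> S"
        using linked_crossing_edge[of E x r S] Z_self by (auto simp: S_def)
      have cross: "(a \<in> side (f r)) \<noteq> (a' \<in> side (f r)) \<longleftrightarrow> {a, a'} = f r"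
        by (rule crossing[OF f(1)[OF \<open>r \<in> M\<close>] a(1)])
      show False
      proof (cases "a' \<in> Z r")
        case True
        then have "0 < w {a', a}"
          using a by (intro leave_pos[of a' a r]) (auto simp: S_def insert_commute)
        then have "{a', a} = f r"
          using True a(1) \<open>r \<in> M\<close> by (intro f_eq[of r _ a']) (auto simp: insert_commute)
        then show False using cross Zside[OF True] a(2) by (auto simp: S_def insert_commute)
      next
        case False
        then have "{a, a'} = f r" using a cross by (auto simp: S_def)
        then show False using uv a(2) False by (auto simp: S_def doubleton_eq_iff)
      qed
    qed
    then show ?thesis using that by blast
  qed
  define h where "h b = w (f b)" for b
  have "cut_dist E side w p q \<le> h p + h q" if pq: "p \<in> M" "q \<in> M" "p \<noteq> q" for p q
  proof -
    have "w e * cut_sep (side e) p q = 0" if e: "e \<in> E - {f p, f q}" for e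
    proof (cases "w e = 0")
      case False
      then have we: "0 < w e" using w[of e] e by auto
      then obtain r where r: "r \<in> e" "r \<in> M" using touch[of e] e by auto
      then have "e = f r" using f_eq[OF r(2) _ we r(1) Z_self] e by auto
      then have "r \<noteq> p" "r \<noteq> q" using e by auto
      then show ?thesis using not_sep[OF pq(1,2) r(2)] \<open>e = f r\<close> by (auto simp: cut_sep_def)
    qed simp
    then have "cut_dist E side w p q = (\<Sum>e\<in>{f p, f q}. w e * cut_sep (side e) p q)"
      unfolding cut_dist_def using finite_E f(1) pq by (intro sum.mono_neutral_right) auto
    also have "\<dots> \<le> (\<Sum>e\<in>{f p, f q}. w e * 1)"
      using f(1) w pq by (intro sum_mono mult_left_mono) (auto simp: cut_sep_def)
    also have "\<dots> = h p + h q"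
    proof -
      have "f p \<noteq> f q" using inj_onD[OF inj _ pq(1,2)] pq(3) by blast
      then show ?thesis by (simp add: h_def)
    qed
    finally show ?thesis .
  qed
  moreover have "sum h M \<le> graph_weight E w"
  proof -
    have "sum h M = sum w (f ` M)" using inj by (simp add: h_def sum.reindex)
    also have "\<dots> \<le> sum w E" using finite_E f(1) w by (intro sum_mono2) auto
    finally show ?thesis by (simp add: graph_weight_def)
  qed
  ultimately show ?thesis using f(2) by (intro exI[of _ h]) (auto simp: h_def)
qed

end

section \<open>Minimal fillings of incommensurable spaces\<close>

theorem corollary11p1:
  fixes M :: "'a::infinite set" and \<rho> :: "'a \<Rightarrow> 'a \<Rightarrow> real"
    and V :: "'a set" and E :: "'a set set" and w :: "'a set \<Rightarrow> real"
  assumes "Metric_space M \<rho>" and "finite M"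
    and "incommensurable M \<rho>"
    and "card M > 3"
    and "minimal_filling M \<rho> V E w"
    and "is_tree V E"
    and "\<And>v. v \<in> V \<Longrightarrow> vertex_degree E v \<in> {1, 2} \<Longrightarrow> v \<in> M"
  shows "\<exists>e\<in>E. interior_edge M e \<and> nondegenerate_edge w e"
proof (rule ccontr)
  assume no_interior: "\<not> ?thesis"
  note met = assms(1) and fin = assms(2) and inc = assms(3)
  have G: "fin_graph V E" "M \<subseteq> V" and w: "\<And>e. e \<in> E \<Longrightarrow> 0 \<le> w e"
    and dist: "\<And>p q. p \<in> M \<Longrightarrow> q \<in> M \<Longrightarrow> \<rho> p q \<le> graph_dist V E w p q"
    and minimal: "\<And>V' E' w'. is_filling M \<rho> V' E' w' \<Longrightarrow> graph_weight E w \<le> graph_weight E' w'"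
    using assms(5) by (auto simp: minimal_filling_def is_filling_def joins_def)
  have self: "\<rho> p p \<le> 0" if "p \<in> M" for p
    using Metric_space.zero[OF met that that] by simp
  obtain side where "tree_cuts V E side"
    using tree_has_cuts[OF G(1) assms(6)] by blast
  then interpret tree_cuts V E side .
  have fill: "\<rho> p q \<le> cut_dist E side w p q" if "p \<in> M" "q \<in> M" for p q
    using dist[OF that] graph_dist_le_cut_dist[of p q w] that G(2) by force
  have "\<exists>h. (\<forall>p\<in>M. 0 < h p) \<and>
      (\<forall>p\<in>M. \<forall>q\<in>M. p \<noteq> q \<longrightarrow> cut_dist E side w p q \<le> h p + h q) \<and> sum h M \<le> graph_weight E w"
  proof (rule star_weights[OF w G(2) fin])
    show "3 \<le> card M" using assms(4) by simp
    show "0 < cut_dist E side w p q" if "p \<in> M" "q \<in> M" "p \<noteq> q" for p q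
    proof -
      have "0 < \<rho> p q"
        using Metric_space.nonneg[OF met, of p q] Metric_space.zero[OF met that(1,2)] that(3)
        by linarith
      then show ?thesis using fill[OF that(1,2)] by simp
    qed
    show "e \<inter> M \<noteq> {}" if "e \<in> E" "0 < w e" for e
      using no_interior that by (auto simp: interior_edge_def nondegenerate_edge_def)
    show "e1 = e2"
      if "b \<in> M" "e1 \<in> E" "0 < w e1" "u1 \<in> e1" "linked {e \<in> E. w e = 0} b u1"
        "e2 \<in> E" "0 < w e2" "u2 \<in> e2" "linked {e \<in> E. w e = 0} b u2" for b e1 e2 u1 u2
    proof (rule ccontr)
      assume "e1 \<noteq> e2"
      with that have "\<exists>V' E' w'. is_filling M \<rho> V' E' w' \<and> graph_weight E' w' < graph_weight E w"
        by (intro split_boundary_vertex[of w M \<rho> b e1 u1 e2 u2] infinite_UNIV w G(2) fin self fill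
            strict_triangle_if_incommensurable[OF met fin inc])
      then obtain V' E' w' where "is_filling M \<rho> V' E' w'" "graph_weight E' w' < graph_weight E w"
        by blast
      then show False using minimal[of V' E' w'] by simp
    qed
  qed
  then obtain h where h0: "\<forall>p\<in>M. 0 < h p"
      "\<forall>p\<in>M. \<forall>q\<in>M. p \<noteq> q \<longrightarrow> cut_dist E side w p q \<le> h p + h q"
      "sum h M \<le> graph_weight E w" by (elim exE conjE) (rule that)
  note h = h0(1)[rule_format] h0(2)[rule_format] h0(3)
  have cover: "\<rho> p q \<le> h p + h q" if "p \<in> M" "q \<in> M" "p \<noteq> q" for p q
    using fill[OF that(1,2)] h(2)[OF that] by simp
  have "\<exists>S k t. 0 \<le> t \<and> (\<forall>p\<in>M. 0 \<le> k p) \<and>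
      (\<forall>p\<in>M. \<forall>q\<in>M. p \<noteq> q \<longrightarrow> \<rho> p q \<le> k p + k q + t * cut_sep S p q) \<and>
      sum k M + t < sum h M"
    using h(1) cover by (rule double_star_beats_star[OF met fin inc assms(4)])
  then obtain S k t where k: "0 \<le> t" "\<forall>p\<in>M. 0 \<le> k p"
      "\<forall>p\<in>M. \<forall>q\<in>M. p \<noteq> q \<longrightarrow> \<rho> p q \<le> k p + k q + t * cut_sep S p q"
      "sum k M + t < sum h M"
    by (elim exE conjE) (rule that)
  have "\<exists>V' E' w'. is_filling M \<rho> V' E' w' \<and> graph_weight E' w' = sum k M + t"
    using fin k(1) k(2)[rule_format] self k(3)[rule_format] by (rule double_star_filling)
  then obtain V' E' w' where "is_filling M \<rho> V' E' w'" "graph_weight E' w' = sum k M + t"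
    by blast
  then show False using minimal[of V' E' w'] k(4) h(3) by simp
qed

end
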